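(* Let $S$ be an $\mathbb{F}_2$-linear set of rank $5$ in $\mathrm{PG}(1,2^5)$ with $|S|>1$. Then either: (a) $S$ contains one point of weight $4$ and $16$ of weight $1$ (and hence is a $4$-club), or (b) $S$ contains one point of weight $3$, and $0$, $2$ or $4$ points of weight $2$, and all others of weight $1$, or (c) $S$ contains $s$ points of weight $2$, where $s\in\{2,3,4,5,6\}$, and all others of weight $1$, or (d) $S$ contains $31$ points of weight $1$ (and hence is scattered). The possible sizes for an $\mathbb{F}_2$-linear set of rank $5$ in $\mathrm{PG}(1,2^5)$ (with more than one point) are $17,19,21,23,25,27$ and $31$, and all these possibilities occur.
   Context: Let $q$ be a prime power. A set $S$ of points of $\mathrm{PG}(1,q^5)=\mathrm{PG}(\mathbb{F}_{q^5}^2)$ is an $\mathbb{F}_q$-linear set of rank $k$ if $S=L_U=\{\langle v\rangle_{q^5} : v\in U\setminus\{0\}\}$ for some $k$-dimensional $\mathbb{F}_q$-subspace $U$ of $\mathbb{F}_{q^5}^2$, where $\langle v\rangle_{q^5}$ is the projective point spanned by $v$. The weight of a point $P=\langle v\rangle_{q^5}$ of $L_U$ is the $\mathbb{F}_q$-dimension of $U\cap\langle v\rangle_{q^5}$. (For linear sets of rank $5$ in $\mathrm{PG}(1,q^5)$ the weight does not depend on the choice of $U$ with $S=L_U$.) A linear set of rank $k$ is scattered if it has precisely $\frac{q^k-1}{q-1}$ points, equivalently all of its points have weight $1$. A $k_0$-club is an $\mathbb{F}_q$-linear set of rank $k$ having one point of weight $k_0$ and all its other points of weight $1$. *)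

theory Defs
  imports Complex_Main "HOL-Library.Product_Plus" "HOL-Library.Cardinality"
begin

text \<open>
  The field \<open>\<bbbF>\<^sub>q\<close> is a type \<open>'f\<close>, regarded as a subfield of the type \<open>'k\<close> along a
  field homomorphism \<open>emb\<close>; the ambient space is \<open>'k \<times> 'k\<close>.
\<close>

locale field_embedding =
  fixes emb :: "'f::field \<Rightarrow> 'k::field"
  assumes emb_add: "emb (a + b) = emb a + emb b"
    and emb_mult: "emb (a * b) = emb a * emb b"
    and emb_one: "emb 1 = 1"

definition scale2 :: "'k::field \<Rightarrow> 'k \<times> 'k \<Rightarrow> 'k \<times> 'k" where
  "scale2 a v = (a * fst v, a * snd v)"

global_interpretation PG: vector_space "scale2 :: 'k::field \<Rightarrow> 'k \<times> 'k \<Rightarrow> 'k \<times> 'k"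
  by unfold_locales (simp_all add: scale2_def algebra_simps)

definition sub_scale :: "('f::field \<Rightarrow> 'k::field) \<Rightarrow> 'f \<Rightarrow> 'k \<times> 'k \<Rightarrow> 'k \<times> 'k" where
  "sub_scale emb c v = scale2 (emb c) v"

sublocale field_embedding \<subseteq> sub: vector_space "sub_scale emb"
  by unfold_locales
    (simp_all add: sub_scale_def scale2_def emb_add emb_mult emb_one algebra_simps)

definition subspace_of_rank ::
    "('f::field \<Rightarrow> 'k::field) \<Rightarrow> nat \<Rightarrow> ('k \<times> 'k) set \<Rightarrow> bool" where
  "subspace_of_rank emb r U \<longleftrightarrow>
     module.subspace (sub_scale emb) U \<and> vector_space.dim (sub_scale emb) U = r"

text \<open>A point of \<open>PG(1,'k)\<close> is the one-dimensional \<open>'k\<close>-subspace of \<open>'k \<times> 'k\<close> that it denotes.\<close>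

definition pt :: "'k::field \<times> 'k \<Rightarrow> ('k \<times> 'k) set" where
  "pt v = PG.span {v}"

definition L :: "('k::field \<times> 'k) set \<Rightarrow> ('k \<times> 'k) set set" where
  "L U = {pt v | v. v \<in> U - {0}}"

definition linear_set ::
    "('f::field \<Rightarrow> 'k::field) \<Rightarrow> nat \<Rightarrow> ('k \<times> 'k) set set \<Rightarrow> bool" where
  "linear_set emb r S \<longleftrightarrow> (\<exists>U. subspace_of_rank emb r U \<and> S = L U)"

text \<open>
  The weight is taken with respect to a given subspace \<open>U\<close> defining the linear set.
\<close>

definition weight ::
    "('f::field \<Rightarrow> 'k::field) \<Rightarrow> ('k \<times> 'k) set \<Rightarrow> ('k \<times> 'k) set \<Rightarrow> nat" where
  "weight emb U P = vector_space.dim (sub_scale emb) (U \<inter> P)"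

definition points_of_weight ::
    "('f::field \<Rightarrow> 'k::field) \<Rightarrow> ('k \<times> 'k) set \<Rightarrow> nat \<Rightarrow> ('k \<times> 'k) set set" where
  "points_of_weight emb U i = {P \<in> L U. weight emb U P = i}"

definition scattered ::
    "('f::field \<Rightarrow> 'k::field) \<Rightarrow> nat \<Rightarrow> ('k \<times> 'k) set set \<Rightarrow> bool" where
  "scattered emb r S \<longleftrightarrow>
     linear_set emb r S \<and> card S = (CARD('f) ^ r - 1) div (CARD('f) - 1)"

definition club ::
    "('f::field \<Rightarrow> 'k::field) \<Rightarrow> nat \<Rightarrow> nat \<Rightarrow> ('k \<times> 'k) set set \<Rightarrow> bool" where
  "club emb r k0 S \<longleftrightarrow>
     (\<exists>U. subspace_of_rank emb r U \<and> S = L U \<and>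
       (\<exists>P\<in>S. weight emb U P = k0 \<and> (\<forall>Q\<in>S - {P}. weight emb U Q = 1)))"

end

theory Submission
  imports Defs "HOL-Computational_Algebra.Primes"
begin

text \<open>
  Write \<open>K\<close> for the field with 32 elements.  In coordinates whose vertical axis is a point outside
  \<open>L U\<close>, the subspace \<open>U\<close> is the graph of an additive map \<open>f : K \<rightarrow> K\<close>; the points of
  \<open>L U\<close> correspond to the slopes \<open>m = f x / x\<close>, and a point of weight \<open>w\<close> is a slope that is taken
  by exactly \<open>2^w - 1\<close> nonzero elements \<open>x\<close>.  So the theorem is about the multiplicities in a list
  of 31 slopes.

  If all weights are 1, the 31 nonzero vectors of \<open>U\<close> lie on 31 different points and \<open>L U\<close> is
  scattered.  Otherwise some point has weight at least 2, and such a point is chosen as the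
  horizontal axis: now \<open>f\<close> vanishes on some \<open>{0, c, c t, c (1 + t)}\<close> with \<open>t \<noteq> 0, 1\<close>.  The key
  observation is that \<open>t\<close> may be normalized.  The six quotients of two different nonzero elements
  of this set are the images of \<open>t\<close> under the group of order 6 generated by \<open>t \<mapsto> 1 + t\<close> and \<open>t \<mapsto> 1 / t\<close>, and this
  group permutes the six irreducible quintics over the prime field regularly, so exactly one of the
  images is a root \<open>\<alpha>\<close> of \<open>x^5 + x^2 + 1\<close> (\<open>quintic_root_in_pencil\<close>).  After a rescaling of the first
  coordinate, \<open>f 1 = f \<alpha> = 0\<close>, so that \<open>f\<close> is determined by its values at \<open>\<alpha>^2\<close>, \<open>\<alpha>^3\<close>, \<open>\<alpha>^4\<close>; a
  rescaling of the second coordinate makes the first nonzero one of these equal to 1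
  (\<open>heavy_point_distribution\<close>).

  This leaves \<open>32^2 + 32 + 1 = 1057\<close> maps.  With elements of \<open>K\<close> written as vectors of five bits
  with respect to the basis \<open>1, \<alpha>, \<dots>, \<alpha>^4\<close>, the list of slopes of such a map is computed by shifts
  and exclusive or, its multiplicities are computed by a radix sort, and all 1057 distributions
  turn out to be among nine (\<open>normalized_distribution_ok\<close>).  The same computation exhibits maps
  for the sizes up to 27, while \<open>f x = x^2\<close> has the slopes \<open>f x / x = x\<close> and gives a scattered set.
\<close>

section \<open>Counting with labels\<close>

text \<open>
  Both images are in bijection with the quotient of \<open>A\<close> by the common kernel.  This allows points to be
  replaced by slopes, and slopes by bit vectors, as long as they separate the same vectors.
\<close>

lemma card_image_same_kernel:
  assumes "\<And>x y. x \<in> A \<Longrightarrow> y \<in> A \<Longrightarrow> f x = f y \<longleftrightarrow> g x = g y"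
  shows "card (f ` A) = card (g ` A)"
proof -
  have "bij_betw (\<lambda>z. g (inv_into A f z)) (f ` A) (g ` A)"
    unfolding bij_betw_def
  proof
    show "inj_on (\<lambda>z. g (inv_into A f z)) (f ` A)"
      by (intro inj_onI) (metis assms f_inv_into_f inv_into_into)
    have "g (inv_into A f (f x)) = g x" if "x \<in> A" for x
      using assms f_inv_into_f inv_into_into that by (metis imageI)
    then show "(\<lambda>z. g (inv_into A f z)) ` f ` A = g ` A"
      by (force simp: image_image)
  qed
  then show ?thesis by (rule bij_betw_same_card)
qed

lemma card_fibre_eq_count_list:
  assumes "bij_betw e {..<n} A"
  shows "card {a \<in> A. T a = m} = count_list (map (\<lambda>i. T (e i)) [0..<n]) m"
proof -
  have "bij_betw e {i. i < n \<and> T (e i) = m} {a \<in> A. T a = m}"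
    using assms by (auto simp: bij_betw_def inj_on_def)
  then have "card {a \<in> A. T a = m} = card {i. i < n \<and> T (e i) = m}"
    by (simp add: bij_betw_same_card)
  also have "\<dots> = count_list (map (\<lambda>i. T (e i)) [0..<n]) m"
    by (auto simp: count_list_eq_length_filter length_filter_conv_card intro!: arg_cong[of _ _ card])
  finally show ?thesis .
qed

section \<open>Histograms of bit vectors\<close>

fun tails_with_head :: "bool \<Rightarrow> bool list list \<Rightarrow> bool list list" where
  "tails_with_head c [] = []"
| "tails_with_head c ((b # bs) # r) =
     (if b = c then bs # tails_with_head c r else tails_with_head c r)"
| "tails_with_head c ([] # r) = tails_with_head c r"

text \<open>
  The multiplicities of the distinct entries of a list of bit vectors of length \<open>n\<close>, obtained by
  distributing the list according to the leading bit (radix sort).  This takes far fewer steps by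
  rewriting than a pairwise comparison of the entries.
\<close>

fun histogram :: "nat \<Rightarrow> bool list list \<Rightarrow> nat list" where
  "histogram n [] = []"
| "histogram 0 l = [length l]"
| "histogram (Suc n) l =
     histogram n (tails_with_head False l) @ histogram n (tails_with_head True l)"

lemma set_tails_with_head: "bs \<in> set (tails_with_head c l) \<longleftrightarrow> c # bs \<in> set l"
  by (induction c l rule: tails_with_head.induct) auto

lemma count_list_tails_with_head: "count_list (tails_with_head c l) bs = count_list l (c # bs)"
  by (induction c l rule: tails_with_head.induct) auto

lemma count_list_all_equal: "(\<And>y. y \<in> set l \<Longrightarrow> y = x) \<Longrightarrow> count_list l x = length l"
  by (induction l) auto

text \<open>
  Vectors with a different leading bit are different, so the entries and their multiplicities
  in \<open>l\<close> are those in the two parts taken together.  Multiplicity 0 is excluded because it is shared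
  by infinitely many lists \<open>bs\<close>.
\<close>

lemma histogram_correct:
  assumes "\<And>bs. bs \<in> set l \<Longrightarrow> length bs = n"
  shows card_set_eq_length_histogram: "card (set l) = length (histogram n l)"
    and card_multiplicity_eq_count_histogram:
      "k > 0 \<Longrightarrow> card {bs. count_list l bs = k} = count_list (histogram n l) k"
proof -
  have "card (set l) = length (histogram n l) \<and>
    (\<forall>k>0. card {bs. count_list l bs = k} = count_list (histogram n l) k)"
    using assms
  proof (induction n l rule: histogram.induct)
    case (1 n)
    then show ?case by simp
  next
    case (2 v va)
    let ?l = "v # va"
    have nil: "bs = []" if "bs \<in> set ?l" for bs using 2 that by auto
    then have s: "set ?l = {[]}" using nil[of v] by auto
    have c: "count_list ?l bs = (if bs = [] then length ?l else 0)" for bs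
      using count_list_all_equal[of ?l "[]"] nil s by (metis count_notin singletonD)
    have "{bs. count_list ?l bs = k} = (if k = length ?l then {[]} else {})" if "k > 0" for k
      using that unfolding c by auto
    then show ?case unfolding s by simp
  next
    case (3 n v va)
    let ?l = "v # va"
    let ?F = "tails_with_head False ?l" and ?T = "tails_with_head True ?l"
    have IHF: "card (set ?F) = length (histogram n ?F) \<and>
        (\<forall>k>0. card {bs. count_list ?F bs = k} = count_list (histogram n ?F) k)"
      by (rule "3.IH"(1)) (use "3.prems" set_tails_with_head in fastforce)
    have IHT: "card (set ?T) = length (histogram n ?T) \<and>
        (\<forall>k>0. card {bs. count_list ?T bs = k} = count_list (histogram n ?T) k)"
      by (rule "3.IH"(2)) (use "3.prems" set_tails_with_head in fastforce)
    have nonempty: "bs \<noteq> []" if "bs \<in> set ?l" for bs using "3.prems" that by fastforce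
    \<comment> \<open>Applied below to the set of all entries and to the set of entries of a given multiplicity.\<close>
    have split: "card B = card {bs. False # bs \<in> B} + card {bs. True # bs \<in> B}"
      if B: "B \<subseteq> set ?l" for B
    proof -
      have eq: "B = (#) False ` {bs. False # bs \<in> B} \<union> (#) True ` {bs. True # bs \<in> B}"
      proof (intro set_eqI iffI)
        fix bs assume "bs \<in> B"
        then obtain b cs where "bs = b # cs" using B nonempty by (metis neq_Nil_conv subsetD)
        then show "bs \<in> (#) False ` {bs. False # bs \<in> B} \<union> (#) True ` {bs. True # bs \<in> B}"
          using \<open>bs \<in> B\<close> by (cases b) auto
      qed auto
      have "finite B" using B finite_subset by blast
      then have fin: "finite ((#) False ` {bs. False # bs \<in> B})" "finite ((#) True ` {bs. True # bs \<in> B})"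
        using eq by (metis finite_Un)+
      show ?thesis
        by (subst (1) eq, subst card_Un_disjoint[OF fin]) (auto simp: card_image)
    qed
    have "card (set ?l) = card (set ?F) + card (set ?T)"
      by (subst split[OF order_refl]) (simp only: set_tails_with_head[symmetric] Collect_mem_eq)
    moreover have "card {bs. count_list ?l bs = k} =
        card {bs. count_list ?F bs = k} + card {bs. count_list ?T bs = k}" if "k > 0" for k
    proof -
      have "{bs. count_list ?l bs = k} \<subseteq> set ?l"
        using that by (metis (mono_tags, lifting) count_list_0_iff mem_Collect_eq not_less_iff_gr_or_eq subsetI)
      from split[OF this] show ?thesis by (simp only: mem_Collect_eq count_list_tails_with_head)
    qed
    ultimately show ?case using IHF IHT by (simp del: tails_with_head.simps)
  qed
  then show "card (set l) = length (histogram n l)"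
    and "k > 0 \<Longrightarrow> card {bs. count_list l bs = k} = count_list (histogram n l) k"
    by auto
qed

section \<open>The field with 32 elements\<close>

text \<open>
  Multiplication by \<open>x\<close> permutes the nonzero elements and hence preserves their product.
\<close>

lemma finite_field_power_card_minus_one:
  fixes x :: "'k::field"
  assumes fin: "finite (UNIV :: 'k set)" and x: "x \<noteq> 0"
  shows "x ^ (CARD('k) - 1) = 1"
proof -
  let ?A = "UNIV - {0 :: 'k}"
  have "bij_betw ((*) x) ?A ?A"
    by (rule bij_betw_byWitness[where f' = "\<lambda>y. y / x"]) (use x in auto)
  then have "(\<Prod>y\<in>?A. x * y) = \<Prod>?A"
    by (rule prod.reindex_bij_betw)
  then have "x ^ card ?A * \<Prod>?A = \<Prod>?A"
    by (simp add: prod.distrib)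
  moreover have "\<Prod>?A \<noteq> 0" using fin by (simp add: prod_zero_iff)
  ultimately show ?thesis using fin by simp
qed

lemma char2_eqI:
  fixes x y z :: "'k::comm_ring_1"
  shows "x = y + 2 * z \<Longrightarrow> (2 :: 'k) = 0 \<Longrightarrow> x = y"
  by simp

text \<open>
  Besides \<open>t\<close> and \<open>t + 1\<close>, the factors are the six irreducible quintics over the field with two
  elements.  The quintics are paired with their reciprocals.  In each step below, \<open>z\<close> is
  half the difference of the two sides, expanded over the integers.
\<close>

lemma char2_quintic_factorization:
  fixes t :: "'k::field"
  assumes char2: "(2::'k) = 0"
  shows "t ^ 32 + t = t * (t + 1) * ((t^5 + t^2 + 1) * (t^5 + t^3 + 1)) *
    ((t^5 + t^3 + t^2 + t + 1) * (t^5 + t^4 + t^3 + t^2 + 1)) *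
    ((t^5 + t^4 + t^3 + t + 1) * (t^5 + t^4 + t^2 + t + 1))"
    (is "_ = t * (t + 1) * ?A * ?B * ?C")
proof -
  have A: "?A = t^10 + t^8 + t^7 + t^5 + t^3 + t^2 + 1" (is "_ = ?a")
    by (rule char2_eqI[OF _ char2, where z = "t^5"]) algebra
  have B: "?B = t^10 + t^9 + t^7 + t^6 + t^5 + t^4 + t^3 + t + 1" (is "_ = ?b")
    by (rule char2_eqI[OF _ char2, where z = "t^8 + t^7 + t^6 + 2 * t^5 + t^4 + t^3 + t^2"]) algebra
  have C: "?C = t^10 + t^6 + t^5 + t^4 + 1" (is "_ = ?c")
    by (rule char2_eqI[OF _ char2,
        where z = "t^9 + t^8 + t^7 + t^6 + 2 * t^5 + t^4 + t^3 + t^2 + t"]) algebra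
  have AB: "t * (t + 1) * ?a * ?b = t^22 + t^18 + t^17 + t^16 + t^14 + t^9 + t^7 + t^6 + t^5 + t"
    (is "_ = ?ab")
    by (rule char2_eqI[OF _ char2,
        where z = "t^21 + t^20 + 2 * t^19 + 2 * t^18 + 2 * t^17 + 3 * t^16 + 4 * t^15 +
          4 * t^14 + 5 * t^13 + 5 * t^12 + 5 * t^11 + 5 * t^10 + 4 * t^9 + 4 * t^8 + 3 * t^7 +
          2 * t^6 + 2 * t^5 + 2 * t^4 + t^3 + t^2"]) algebra
  have "?ab * ?c = t^32 + t"
    by (rule char2_eqI[OF _ char2,
        where z = "t^28 + t^27 + t^26 + t^24 + t^23 + 2 * t^22 + t^21 + t^20 + t^19 + t^18 +
          t^17 + t^16 + t^15 + t^14 + t^13 + t^12 + 2 * t^11 + t^10 + t^9 + t^7 + t^6 + t^5"]) algebra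
  then show ?thesis unfolding A B C AB by simp
qed

text \<open>
  The elements of \<open>{c, c t, c (1 + t)}\<close> are the nonzero vectors in the span of \<open>c\<close> and \<open>c t\<close>
  over the field with two elements.  If the set contains 1, then its other elements are of the form
  \<open>t\<close>, \<open>1 + t\<close>, \<open>1 / t\<close>, \<open>(1 + t) / t\<close>, \<open>1 / (1 + t)\<close> or \<open>t / (1 + t)\<close>, and each of the six quintics
  in \<open>t\<close> becomes \<open>x^5 + x^2 + 1\<close> under exactly one of the substitutions for \<open>x\<close>.  As \<open>t\<close> is a root of
  one of the quintics, one of the six elements is the required root \<open>a\<close>.
\<close>

lemma quintic_root_in_pencil:
  fixes t :: "'k::field"
  assumes char2: "(2::'k) = 0" and t: "t ^ 32 = t" "t \<noteq> 0" "t \<noteq> 1"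
  obtains c a where "a ^ 5 = a ^ 2 + 1" "1 \<in> {c, c * t, c * (1 + t)}" "a \<in> {c, c * t, c * (1 + t)}"
proof -
  have neg: "- x = x" for x :: 'k
    using char2 by (metis add_eq_0_iff2 mult_2 mult_zero_left)
  have t1: "1 + t \<noteq> 0" "t + 1 \<noteq> 0" using t(3) neg by (metis add_eq_0_iff2 add.commute)+
  have "t ^ 32 + t = 0" using t(1) neg by (metis add.right_inverse)
  then have "(t^5 + t^2 + 1) * (t^5 + t^3 + 1) *
    ((t^5 + t^3 + t^2 + t + 1) * (t^5 + t^4 + t^3 + t^2 + 1)) *
    ((t^5 + t^4 + t^3 + t + 1) * (t^5 + t^4 + t^2 + t + 1)) = 0"
    using char2_quintic_factorization[OF char2, of t] t(2) t1 by simp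
  then consider "t^5 + t^2 + 1 = 0" | "t^5 + t^4 + t^2 + t + 1 = 0" | "t^5 + t^3 + 1 = 0" |
    "t^5 + t^4 + t^3 + t + 1 = 0" | "t^5 + t^4 + t^3 + t^2 + 1 = 0" | "t^5 + t^3 + t^2 + t + 1 = 0"
    by auto
  moreover have quotient: "(p / d) ^ 5 = (p / d) ^ 2 + 1"
    if "p ^ 5 = p ^ 2 * d ^ 3 + d ^ 5" "d \<noteq> 0" for p d :: 'k
  proof -
    have "(p / d) ^ 5 = (p ^ 2 * d ^ 3 + d ^ 5) / d ^ 5" using that by (simp add: power_divide)
    also have "\<dots> = p ^ 2 * d ^ 3 / d ^ 5 + 1" using that by (simp add: add_divide_distrib)
    also have "p ^ 2 * d ^ 3 / d ^ 5 = (p / d) ^ 2" using that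
      by (simp add: power_divide field_simps flip: power_add)
    finally show ?thesis .
  qed
  ultimately show thesis
  proof cases
    case 1
    have "t ^ 5 = t ^ 2 + 1"
      by (rule char2_eqI[OF _ char2, where z = "t^5"]) (use 1 in algebra)
    then show ?thesis by (rule that[of t 1]) auto
  next
    case 2
    have "(1 + t) ^ 5 = (1 + t) ^ 2 + 1"
      by (rule char2_eqI[OF _ char2,
        where z = "t^5 + 3 * t^4 + 5 * t^3 + 5 * t^2 + 2 * t"]) (use 2 in algebra)
    then show ?thesis by (rule that[of "1 + t" 1]) auto
  next
    case 3
    have "1 = t ^ 3 + t ^ 5"
      by (rule char2_eqI[OF _ char2, where z = "1"]) (use 3 in algebra)
    then have "1 ^ 5 = 1 ^ 2 * t ^ 3 + t ^ 5" by simp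
    from quotient[OF this t(2)] show ?thesis by (rule that[of _ "1 / t"]) (use t in auto)
  next
    case 4
    have "(1 + t) ^ 5 = (1 + t) ^ 2 * t ^ 3 + t ^ 5"
      by (rule char2_eqI[OF _ char2,
        where z = "2 * t^4 + 5 * t^3 + 5 * t^2 + 3 * t + 1"]) (use 4 in algebra)
    from quotient[OF this t(2)] show ?thesis by (rule that[of _ "1 / t"]) (use t in auto)
  next
    case 5
    have "1 = (1 + t) ^ 3 + (1 + t) ^ 5"
      by (rule char2_eqI[OF _ char2,
        where z = "- (2 * t^4 + 5 * t^3 + 6 * t^2 + 4 * t)"]) (use 5 in algebra)
    then have "1 ^ 5 = 1 ^ 2 * (1 + t) ^ 3 + (1 + t) ^ 5" by simp
    from quotient[OF this t1(1)] show ?thesis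
      by (rule that[of _ "1 / (1 + t)"]) (use t t1 in auto)
  next
    case 6
    have "t ^ 5 = t ^ 2 * (1 + t) ^ 3 + (1 + t) ^ 5"
      by (rule char2_eqI[OF _ char2,
        where z = "- (4 * t^4 + 6 * t^3 + 5 * t^2 + 2 * t)"]) (use 6 in algebra)
    from quotient[OF this t1(1)] show ?thesis
      by (rule that[of _ "1 / (1 + t)"]) (use t t1 in auto)
  qed
qed

section \<open>Bit vectors as elements of the field\<close>

fun add_bits :: "bool list \<Rightarrow> bool list \<Rightarrow> bool list" where
  "add_bits (a # as) (b # bs) = (if a then \<not> b else b) # add_bits as bs"
| "add_bits _ _ = []"

text \<open>
  Bits are listed from the coefficient of 1 to the coefficient of \<open>\<alpha>^4\<close>.  The two shifts are
  multiplication and division by \<open>\<alpha>\<close>; the wrap-around uses \<open>\<alpha>^5 = 1 + \<alpha>^2\<close> and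
  \<open>1 / \<alpha> = \<alpha> + \<alpha>^4\<close>.
\<close>

fun mult_root :: "bool list \<Rightarrow> bool list" where
  "mult_root [a, b, c, d, e] = [e, a, if e then \<not> b else b, c, d]"
| "mult_root p = p"

fun div_root :: "bool list \<Rightarrow> bool list" where
  "div_root [a, b, c, d, e] = [b, if a then \<not> c else c, d, e, a]"
| "div_root p = p"

definition zero_bits :: "bool list" where "zero_bits = [False, False, False, False, False]"
definition one_bits :: "bool list" where "one_bits = [True, False, False, False, False]"

text \<open>
  The value at \<open>p\<close> of the additive map that sends \<open>1, \<alpha>, \<alpha>^2, \<alpha>^3, \<alpha>^4\<close> to \<open>0, 0, u, v, w\<close>.
\<close>

fun combine :: "bool list \<Rightarrow> bool list \<Rightarrow> bool list \<Rightarrow> bool list \<Rightarrow> bool list" where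
  "combine [a, b, c, d, e] u v w = add_bits (if c then u else zero_bits)
     (add_bits (if d then v else zero_bits) (if e then w else zero_bits))"
| "combine p u v w = []"

text \<open>
  The slopes \<open>f x / x\<close> at \<open>n\<close> successive powers \<open>x\<close> of \<open>\<alpha>\<close>.  Instead of a division by \<open>x\<close> of the
  value of \<open>f\<close>, the values \<open>u, v, w\<close> that define \<open>f\<close> are divided by \<open>\<alpha>\<close> whenever \<open>x\<close> is multiplied by
  \<open>\<alpha>\<close>, so that only shifts are needed.
\<close>

fun slopes :: "nat \<Rightarrow> bool list \<Rightarrow> bool list \<Rightarrow> bool list \<Rightarrow> bool list \<Rightarrow> bool list list" where
  "slopes 0 p u v w = []"
| "slopes (Suc n) p u v w =
     combine p u v w # slopes n (mult_root p) (div_root u) (div_root v) (div_root w)"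

lemma length5E:
  assumes "length p = 5"
  obtains a b c d e where "p = [a, b, c, d, e]"
  using assms by (auto simp: numeral_eq_Suc length_Suc_conv)

lemma length_mult_root [simp]: "length (mult_root p) = length p"
  by (induction p rule: mult_root.induct) auto

lemma length_div_root [simp]: "length (div_root p) = length p"
  by (induction p rule: div_root.induct) auto

lemma length_add_bits [simp]: "length (add_bits p q) = min (length p) (length q)"
  by (induction p q rule: add_bits.induct) auto

lemma length_const_bits [simp]: "length zero_bits = 5" "length one_bits = 5"
  by (simp_all add: zero_bits_def one_bits_def)

lemma length_combine:
  "length p = 5 \<Longrightarrow> length u = 5 \<Longrightarrow> length v = 5 \<Longrightarrow> length w = 5 \<Longrightarrow> length (combine p u v w) = 5"
  by (erule length5E) simp

lemma length_slopes_entry: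
  assumes "length p = 5" "length u = 5" "length v = 5" "length w = 5" "bs \<in> set (slopes n p u v w)"
  shows "length bs = 5"
  using assms by (induction n p u v w rule: slopes.induct) (auto simp: length_combine)

locale quintic_field =
  fixes \<alpha> :: "'k::field"
  assumes char2: "(2 :: 'k) = 0"
    and card_field: "CARD('k) = 32"
    and root: "\<alpha> ^ 5 = \<alpha> ^ 2 + 1"
begin

lemma finite_field: "finite (UNIV :: 'k set)"
  by (rule card_ge_0_finite) (simp add: card_field)

lemma add_self [simp]: "x + x = (0 :: 'k)"
  using char2 by (metis mult_2 mult_zero_left)

lemma add_self_left [simp]: "x + (x + y) = (y :: 'k)"
  by (simp flip: add.assoc)

lemma root_nonzero: "\<alpha> \<noteq> 0" using root by auto

lemma root_power_31: "\<alpha> ^ 31 = 1"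
  using finite_field_power_card_minus_one[OF finite_field root_nonzero] by (simp add: card_field)

text \<open>
  The order of \<open>\<alpha>\<close> divides the prime 31 and is not 1, so that \<open>\<alpha>\<close> is a primitive element.
\<close>

lemma root_power_eq_1: assumes "\<alpha> ^ i = 1" shows "31 dvd i"
proof (rule ccontr)
  assume n: "\<not> 31 dvd i"
  have "prime (31 :: nat)" by simp
  then have "coprime i 31" using n prime_imp_coprime coprime_commute by blast
  moreover have "i \<noteq> 0" using n by (metis dvd_0_right)
  ultimately obtain x y where "i * x = 31 * y + 1"
    using bezout_nat[of i 31] by auto
  then have "\<alpha> = \<alpha> ^ (i * x)" by (simp add: power_mult root_power_31)
  also have "\<dots> = 1" by (simp add: power_mult assms)
  finally show False using root by simp
qed

lemma bij_betw_root_powers: "bij_betw (\<lambda>i. \<alpha> ^ i) {..<31} (UNIV - {0})"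
proof -
  have "i = j" if "\<alpha> ^ i = \<alpha> ^ j" "i \<le> j" "j < 31" for i j
  proof -
    have "\<alpha> ^ i * \<alpha> ^ (j - i) = \<alpha> ^ j" using that(2) by (simp flip: power_add)
    then have "\<alpha> ^ i * \<alpha> ^ (j - i) = \<alpha> ^ i" using that(1) by simp
    then have "31 dvd j - i" using root_power_eq_1 root_nonzero by simp
    moreover have "j - i < 31" using that(3) by simp
    ultimately have "j - i = 0" by (metis gr0I nat_dvd_not_less)
    then show ?thesis using that(2) by simp
  qed
  then have inj: "inj_on (\<lambda>i. \<alpha> ^ i) {..<31}"
    by (intro inj_onI) (metis lessThan_iff nat_le_linear)
  moreover have "(\<lambda>i. \<alpha> ^ i) ` {..<31} = UNIV - {0}"
    by (rule card_seteq) (use root_nonzero finite_field card_field inj in \<open>auto simp: card_image\<close>)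
  ultimately show ?thesis by (simp add: bij_betw_def)
qed

primrec val :: "bool list \<Rightarrow> 'k" where
  "val [] = 0"
| "val (b # bs) = of_bool b + \<alpha> * val bs"

lemma val_zero_bits [simp]: "val zero_bits = 0" by (simp add: zero_bits_def)
lemma val_one_bits [simp]: "val one_bits = 1" by (simp add: one_bits_def)

lemma val_add_bits: "length p = length q \<Longrightarrow> val (add_bits p q) = val p + val q"
  by (induction p q rule: add_bits.induct) (auto simp: algebra_simps)

lemma val_mult_root: "length p = 5 \<Longrightarrow> val (mult_root p) = \<alpha> * val p"
proof (erule length5E)
  fix a b c d e assume p: "p = [a, b, c, d, e]"
  have "of_bool e * \<alpha> ^ 5 = of_bool e * \<alpha> ^ 2 + of_bool e" using root by (simp add: algebra_simps)
  then show ?thesis unfolding p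
    by (cases b; cases e) (simp_all add: algebra_simps power2_eq_square power_numeral_reduce)
qed

lemma div_root_mult_root: "length p = 5 \<Longrightarrow> mult_root (div_root p) = p"
  by (erule length5E) auto

lemma val_div_root: "length p = 5 \<Longrightarrow> val (div_root p) = val p / \<alpha>"
  using val_mult_root[of "div_root p"] root_nonzero by (simp add: div_root_mult_root field_simps)

lemma ex_val: "\<exists>p. length p = 5 \<and> val p = x"
proof (cases "x = 0")
  case True
  then show ?thesis using val_zero_bits length_const_bits by blast
next
  case False
  then obtain i where x: "x = \<alpha> ^ i" using bij_betw_root_powers by (auto simp: bij_betw_def)
  have "\<exists>p. length p = 5 \<and> val p = \<alpha> ^ i"
  proof (induction i)
    case 0
    then show ?case using val_one_bits length_const_bits by (metis power_0)
  next
    case (Suc i)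
    then show ?case using val_mult_root length_mult_root by (metis power_Suc)
  qed
  then show ?thesis by (simp add: x)
qed

text \<open>
  All powers of \<open>\<alpha>\<close> are values of bit vectors, by repeated shifting, so the map is onto; it is
  injective because there are just 32 bit vectors.
\<close>

lemma bij_betw_val: "bij_betw val {p. length p = 5} UNIV"
proof -
  have card: "card {p :: bool list. length p = 5} = 32" and fin: "finite {p :: bool list. length p = 5}"
    using card_lists_length_eq[of "UNIV :: bool set" 5] finite_lists_length_eq[of "UNIV :: bool set" 5]
    by (simp_all add: numeral_eq_Suc)
  have surj: "val ` {p. length p = 5} = UNIV" using ex_val by (auto simp: image_iff) metis
  then have "inj_on val {p. length p = 5}"
    using fin card card_field by (intro eq_card_imp_inj_on) auto
  then show ?thesis using surj by (simp add: bij_betw_def)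
qed

lemma val_eq_iff: "length p = 5 \<Longrightarrow> length q = 5 \<Longrightarrow> val p = val q \<longleftrightarrow> p = q"
  using bij_betw_val by (auto simp: bij_betw_def inj_on_def)

lemma additive_eq_combine:
  assumes add: "\<And>x y. f (x + y) = f x + f y" and ker: "f 1 = 0" "f \<alpha> = 0"
    and uvw: "f (\<alpha> ^ 2) = val u" "f (\<alpha> ^ 3) = val v" "f (\<alpha> ^ 4) = val w"
    and len: "length p = 5" "length u = 5" "length v = 5" "length w = 5"
  shows "f (val p) = val (combine p u v w)"
proof -
  obtain a b c d e where p: "p = [a, b, c, d, e]" using len(1) by (rule length5E)
  have f0: "f 0 = 0" using add[of 0 0] by simp
  have "val p = of_bool a * 1 + (of_bool b * \<alpha> + (of_bool c * \<alpha> ^ 2 + (of_bool d * \<alpha> ^ 3 + of_bool e * \<alpha> ^ 4)))"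
    unfolding p by (simp add: algebra_simps power_numeral_reduce)
  then have "f (val p) = f (of_bool a * 1) + (f (of_bool b * \<alpha>) + (f (of_bool c * \<alpha> ^ 2) +
      (f (of_bool d * \<alpha> ^ 3) + f (of_bool e * \<alpha> ^ 4))))"
    by (simp only: add)
  also have "\<dots> = of_bool c * val u + (of_bool d * val v + of_bool e * val w)"
    using f0 ker uvw by (cases a; cases b; cases c; cases d; cases e) auto
  also have "\<dots> = val (combine p u v w)"
    using len by (auto simp: p val_add_bits)
  finally show ?thesis .
qed

text \<open>
  For the induction, the first power \<open>\<alpha>^i\<close> is arbitrary; the recursion then runs on the map
  \<open>f x / \<alpha>^i\<close>, which is additive with the same kernel.
\<close>

lemma val_slopes:
  assumes add: "\<And>x y. f (x + y) = f x + f y" and ker: "f 1 = 0" "f \<alpha> = 0"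
    and uvw: "f (\<alpha> ^ 2) = val u" "f (\<alpha> ^ 3) = val v" "f (\<alpha> ^ 4) = val w"
    and len: "length u = 5" "length v = 5" "length w = 5"
  shows "map val (slopes n one_bits u v w) = map (\<lambda>i. f (\<alpha> ^ i) / \<alpha> ^ i) [0..<n]"
proof -
  have "map val (slopes n p u' v' w') = map (\<lambda>j. f (\<alpha> ^ j) / \<alpha> ^ j) [i..<i + n]"
    if "length p = 5" "length u' = 5" "length v' = 5" "length w' = 5" "val p = \<alpha> ^ i"
      "val u' = val u / \<alpha> ^ i" "val v' = val v / \<alpha> ^ i" "val w' = val w / \<alpha> ^ i"
    for i p u' v' w'
    using that
  proof (induction n arbitrary: i p u' v' w')
    case 0
    then show ?case by simp
  next
    case (Suc n)
    let ?g = "\<lambda>x. f x / \<alpha> ^ i"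
    have "?g (val p) = val (combine p u' v' w')"
      by (rule additive_eq_combine) (use Suc.prems ker uvw in \<open>auto simp: add add_divide_distrib\<close>)
    moreover have "map val (slopes n (mult_root p) (div_root u') (div_root v') (div_root w')) =
        map (\<lambda>j. f (\<alpha> ^ j) / \<alpha> ^ j) [Suc i..<Suc i + n]"
      by (rule Suc.IH) (use Suc.prems in \<open>auto simp: val_mult_root val_div_root\<close>)
    ultimately show ?case using Suc.prems(5) by (simp add: upt_rec[of i])
  qed
  from this[of one_bits u v w 0] show ?thesis using len by simp
qed

end

section \<open>Points of the projective line\<close>

text \<open>
  The linear forms on the plane are the maps \<open>det2 a\<close>; the one for \<open>a \<noteq> 0\<close> vanishes exactly on the
  point \<open>pt a\<close>.  They serve as coordinates.
\<close>

definition det2 :: "'k::field \<times> 'k \<Rightarrow> 'k \<times> 'k \<Rightarrow> 'k" where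
  "det2 u v = fst u * snd v - snd u * fst v"

lemma det2_add: "det2 a (u + v) = det2 a u + det2 a v"
  by (simp add: det2_def algebra_simps)

lemma det2_scale: "det2 a (scale2 c u) = c * det2 a u"
  by (simp add: det2_def scale2_def algebra_simps)

lemma det2_scale_left: "det2 (scale2 c a) u = c * det2 a u"
  by (simp add: det2_def scale2_def algebra_simps)

lemma det2_swap: "det2 a b = - det2 b a"
  by (simp add: det2_def algebra_simps)

lemma det2_self [simp]: "det2 a a = 0" and det2_zero [simp]: "det2 a 0 = 0"
  by (simp_all add: det2_def)

text \<open>
  If \<open>a\<close> and \<open>q\<close> span different points, then by this identity two nonzero vectors have proportional
  coordinates \<open>(det2 a _, det2 q _)\<close> exactly when they lie on the same point.
\<close>

lemma pluecker: "det2 a u * det2 q v - det2 a v * det2 q u = det2 a q * det2 u v"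
  by (simp add: det2_def algebra_simps)

lemma pt_eq_scale: "pt v = range (\<lambda>c. scale2 c v)"
  by (simp add: pt_def PG.span_singleton)

lemma pt_self [simp]: "v \<in> pt v"
  unfolding pt_def by (simp add: PG.span_base)

lemma mem_pt_iff:
  assumes "v \<noteq> 0"
  shows "u \<in> pt v \<longleftrightarrow> det2 v u = 0"
proof
  assume "u \<in> pt v"
  then show "det2 v u = 0" by (auto simp: pt_eq_scale det2_scale)
next
  assume d: "det2 v u = 0"
  have "\<exists>c. u = scale2 c v"
  proof (cases "fst v = 0")
    case False
    then have "u = scale2 (fst u / fst v) v"
      using d by (auto simp: det2_def scale2_def prod_eq_iff field_simps)
    then show ?thesis ..
  next
    case True
    then have "snd v \<noteq> 0" using assms by (auto simp: prod_eq_iff)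
    then have "u = scale2 (snd u / snd v) v"
      using d True by (auto simp: det2_def scale2_def prod_eq_iff field_simps)
    then show ?thesis ..
  qed
  then show "u \<in> pt v" by (auto simp: pt_eq_scale)
qed

lemma pt_eq_iff:
  assumes "u \<noteq> 0" "v \<noteq> 0"
  shows "pt u = pt v \<longleftrightarrow> det2 u v = 0"
proof
  assume "pt u = pt v"
  then show "det2 u v = 0" using mem_pt_iff[OF assms(1)] pt_self by blast
next
  assume "det2 u v = 0"
  then have "v \<in> pt u" using mem_pt_iff[OF assms(1)] by blast
  then obtain c where c: "v = scale2 c u" unfolding pt_eq_scale by blast
  then have "c \<noteq> 0" using assms(2) by (auto simp: scale2_def prod_eq_iff)
  then show "pt u = pt v"
    by (intro set_eqI, simp only: mem_pt_iff[OF assms(1)] mem_pt_iff[OF assms(2)])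
      (simp add: c det2_scale_left)
qed

lemma pt_eq_iff_mem: "u \<noteq> 0 \<Longrightarrow> v \<noteq> 0 \<Longrightarrow> pt u = pt v \<longleftrightarrow> u \<in> pt v"
  using pt_eq_iff[of v u] mem_pt_iff[of v u] by auto

section \<open>Subspaces over the field with two elements\<close>

locale binary_plane = field_embedding emb for emb :: "'f::field \<Rightarrow> 'k::field" +
  assumes card_prime_field: "CARD('f) = 2"
    and card_big_field: "CARD('k) = 2 ^ 5"
begin

lemma finite_UNIV_field [simp]: "finite (UNIV :: 'k set)"
  by (rule card_ge_0_finite) (simp add: card_big_field)

lemma finite_plane [simp]: "finite (A :: ('k \<times> 'k) set)"
  by (rule finite_subset[OF subset_UNIV]) (simp add: finite_Prod_UNIV)

lemma prime_field_cases: "c = 0 \<or> c = (1 :: 'f)"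
proof -
  have "finite (UNIV :: 'f set)" by (rule card_ge_0_finite) (simp add: card_prime_field)
  then have "{0, 1 :: 'f} = UNIV" by (rule card_seteq) (simp_all add: card_prime_field)
  then show ?thesis by (metis UNIV_I empty_iff insertE)
qed

lemma emb_zero: "emb 0 = 0"
  using emb_add[of 0 0] by (metis add.right_neutral add_left_cancel)

lemma char2: "(2 :: 'k) = 0"
proof -
  have "(1 :: 'f) + 1 = 0" using prime_field_cases[of "1 + 1"]
    by (metis add_left_cancel add.right_neutral zero_neq_one)
  then have "(1 :: 'k) + 1 = 0" using emb_add[of 1 1] emb_one emb_zero by simp
  then show ?thesis by simp
qed

lemma field_add_self [simp]: "x + x = (0 :: 'k)"
  using char2 by (metis mult_2 mult_zero_left)

lemma vec_add_self [simp]: "v + v = (0 :: 'k \<times> 'k)"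
  by (simp add: prod_eq_iff)

lemma power_32: "t \<noteq> 0 \<Longrightarrow> t ^ 32 = (t :: 'k)"
  using finite_field_power_card_minus_one[OF finite_UNIV_field, of t] power_Suc[of t 31]
  by (simp add: card_big_field)

lemma sub_scale_cases: "sub_scale emb c v = 0 \<or> sub_scale emb c v = v"
  using prime_field_cases[of c]
  by (auto simp: sub_scale_def scale2_def emb_zero emb_one prod_eq_iff)

lemma subspace_iff:
  "sub.subspace U \<longleftrightarrow> 0 \<in> U \<and> (\<forall>u\<in>U. \<forall>v\<in>U. u + v \<in> U)"
  unfolding sub.subspace_def by (metis sub_scale_cases)

text \<open>
  Adjoining an independent vector \<open>a\<close> to \<open>B\<close> adds the coset \<open>a + span B\<close>, since the only scalars
  are 0 and 1.
\<close>

lemma card_span_independent: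
  assumes "sub.independent B"
  shows "card (sub.span B) = 2 ^ card B"
proof -
  have "finite B" by simp
  then show ?thesis using assms
  proof (induction B)
    case empty
    then show ?case by simp
  next
    case (insert a B)
    let ?V = "sub.span B"
    have a: "a \<notin> ?V" and B: "sub.independent B"
      using insert.prems insert.hyps by (auto simp: sub.independent_insert)
    have "sub.span (insert a B) = ?V \<union> (+) a ` ?V"
    proof (intro set_eqI iffI)
      fix x assume "x \<in> sub.span (insert a B)"
      then obtain k where k: "x - sub_scale emb k a \<in> ?V" by (auto simp: sub.span_breakdown_eq)
      show "x \<in> ?V \<union> (+) a ` ?V"
      proof (cases "sub_scale emb k a = 0")
        case True
        then show ?thesis using k by (simp del: sub.scale_eq_0_iff)
      next
        case False
        then have "x - a \<in> ?V" using k sub_scale_cases by metis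
        then have "a + (x - a) \<in> (+) a ` ?V" by blast
        then show ?thesis by simp
      qed
    next
      fix x assume "x \<in> ?V \<union> (+) a ` ?V"
      then consider "x - sub_scale emb 0 a \<in> ?V" | "x - sub_scale emb 1 a \<in> ?V"
        by auto
      then show "x \<in> sub.span (insert a B)" by cases (auto simp only: sub.span_breakdown_eq)
    qed
    moreover have "?V \<inter> (+) a ` ?V = {}"
    proof -
      have "a + y \<notin> ?V" if "y \<in> ?V" for y
        using sub.span_diff[of "a + y" B y] that a by auto
      then show ?thesis by auto
    qed
    ultimately have "card (sub.span (insert a B)) = card ?V + card ((+) a ` ?V)"
      by (simp add: card_Un_disjoint)
    also have "\<dots> = 2 * 2 ^ card B" using insert.IH[OF B] by (simp add: card_image)
    finally show ?case using insert.hyps by simp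
  qed
qed

lemma card_subspace:
  assumes "sub.subspace V"
  shows "card V = 2 ^ sub.dim V"
proof -
  obtain B where B: "B \<subseteq> V" "sub.independent B" "V \<subseteq> sub.span B" "card B = sub.dim V"
    using sub.basis_exists[of V] by blast
  then have "sub.span B = V" using assms by (metis sub.span_subspace)
  then show ?thesis using card_span_independent[OF B(2)] B(4) by simp
qed

lemma rank_iff_card:
  "subspace_of_rank emb r U \<longleftrightarrow> sub.subspace U \<and> card U = 2 ^ r"
  unfolding subspace_of_rank_def using card_subspace by auto

lemma subspace_pt: "sub.subspace (pt v)"
  unfolding subspace_iff pt_eq_scale
proof (intro conjI ballI)
  show "0 \<in> range (\<lambda>c. scale2 c v)" by (rule range_eqI[of _ _ 0]) (simp add: scale2_def zero_prod_def)
  fix x y assume "x \<in> range (\<lambda>c. scale2 c v)" "y \<in> range (\<lambda>c. scale2 c v)"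
  then obtain c d where "x = scale2 c v" "y = scale2 d v" by auto
  then show "x + y \<in> range (\<lambda>c. scale2 c v)"
    by (intro range_eqI[of _ _ "c + d"]) (simp add: PG.scale_left_distrib)
qed

lemma card_weight:
  assumes "sub.subspace U"
  shows "card (U \<inter> pt v) = 2 ^ weight emb U (pt v)"
  unfolding weight_def by (intro card_subspace sub.subspace_inter assms subspace_pt)

text \<open>
  \<open>T\<close> is any labelling of the nonzero vectors of \<open>U\<close> that separates exactly the points of \<open>L U\<close>, such
  as the slope in suitable coordinates.  The fibre of a label consists of the nonzero vectors of
  \<open>U\<close> on one point.
\<close>

lemma weight_label:
  assumes U: "sub.subspace U"
    and T: "\<And>u v. u \<in> U - {0} \<Longrightarrow> v \<in> U - {0} \<Longrightarrow> T u = T v \<longleftrightarrow> pt u = pt v"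
    and v: "v \<in> U - {0}"
  shows "card {u \<in> U - {0}. T u = T v} = 2 ^ weight emb U (pt v) - 1"
proof -
  have "{u \<in> U - {0}. T u = T v} = (U \<inter> pt v) - {0}"
  proof (intro set_eqI iffI)
    fix u assume "u \<in> {u \<in> U - {0}. T u = T v}"
    then show "u \<in> (U \<inter> pt v) - {0}" using T[of u v] v pt_eq_iff_mem[of u v] by simp
  next
    fix u assume "u \<in> (U \<inter> pt v) - {0}"
    then show "u \<in> {u \<in> U - {0}. T u = T v}" using T[of u v] v pt_eq_iff_mem[of u v] by simp
  qed
  moreover have "0 \<in> U \<inter> pt v" using sub.subspace_0[OF U] sub.subspace_0[OF subspace_pt] by simp
  ultimately show ?thesis using card_weight[OF U, of v] by simp
qed

lemma L_eq_image: "L U = pt ` (U - {0})"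
  by (auto simp: L_def)

text \<open>
  The weight of a point is determined by the size of the fibre of its label.  For \<open>i = 0\<close> the
  right hand side would count the labels of no vector.
\<close>

lemma card_points_of_weight_label:
  assumes U: "sub.subspace U"
    and T: "\<And>u v. u \<in> U - {0} \<Longrightarrow> v \<in> U - {0} \<Longrightarrow> T u = T v \<longleftrightarrow> pt u = pt v"
    and i: "i > 0"
  shows "card (points_of_weight emb U i) = card {m. card {u \<in> U - {0}. T u = m} = 2 ^ i - 1}"
proof -
  let ?B = "{v \<in> U - {0}. weight emb U (pt v) = i}"
  have "points_of_weight emb U i = pt ` ?B"
    by (auto simp: points_of_weight_def L_eq_image)
  also have "card \<dots> = card (T ` ?B)"
    by (rule card_image_same_kernel) (use T in auto)
  also have "T ` ?B = {m. card {u \<in> U - {0}. T u = m} = 2 ^ i - 1}"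
  proof (intro set_eqI iffI)
    fix m assume "m \<in> T ` ?B"
    then show "m \<in> {m. card {u \<in> U - {0}. T u = m} = 2 ^ i - 1}"
      using weight_label[OF U T] by auto
  next
    fix m assume m: "m \<in> {m. card {u \<in> U - {0}. T u = m} = 2 ^ i - 1}"
    have pos: "(2::nat) ^ i - 1 > 0" using i one_less_power[of "2::nat" i] by simp
    have fibre: "card {u \<in> U - {0}. T u = m} = 2 ^ i - 1" using m by (rule CollectD)
    have "{u \<in> U - {0}. T u = m} \<noteq> {}"
    proof
      assume "{u \<in> U - {0}. T u = m} = {}"
      then show False using fibre pos by (simp only: card.empty less_irrefl)
    qed
    then obtain v where v: "v \<in> U - {0}" "T v = m" by blast
    have "(2::nat) ^ weight emb U (pt v) - 1 = 2 ^ i - 1"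
      using weight_label[OF U T v(1)] fibre by (simp only: v(2))
    moreover have "(2::nat) ^ weight emb U (pt v) \<ge> 1" "(2::nat) ^ i \<ge> 1" by simp_all
    ultimately have "(2::nat) ^ weight emb U (pt v) = 2 ^ i" by linarith
    then have "weight emb U (pt v) = i" by simp
    then show "m \<in> T ` ?B" using v by auto
  qed
  finally show ?thesis .
qed

lemma card_L_label:
  assumes T: "\<And>u v. u \<in> U - {0} \<Longrightarrow> v \<in> U - {0} \<Longrightarrow> T u = T v \<longleftrightarrow> pt u = pt v"
  shows "card (L U) = card (T ` (U - {0}))"
  unfolding L_eq_image by (rule card_image_same_kernel) (use T in auto)

end

section \<open>Evaluation of all normalized maps\<close>

text \<open>
  The entries of \<open>h\<close> are the multiplicities \<open>2^i - 1\<close> of slopes, for points of weight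
  \<open>i = 4, 3, 2, 1\<close>.  Each quadruple satisfies \<open>15 n4 + 7 n3 + 3 n2 + n1 = 31\<close>; the content is which of
  the solutions appear.
\<close>

definition distribution_ok :: "nat list \<Rightarrow> bool" where
  "distribution_ok h \<longleftrightarrow>
     (count_list h 15, count_list h 7, count_list h 3, count_list h 1) \<in> set
       [(1, 0, 0, 16),
        (0, 1, 0, 24), (0, 1, 2, 18), (0, 1, 4, 12),
        (0, 0, 2, 25), (0, 0, 3, 22), (0, 0, 4, 19), (0, 0, 5, 16), (0, 0, 6, 13)]"

text \<open>
  The two loops are recursive functions and not bounded quantifiers: evaluation by rewriting would
  enter the body of a quantifier and expand the slopes symbolically, before the bits are known.
\<close>

fun all_last_ok :: "bool list \<Rightarrow> bool list \<Rightarrow> bool list list \<Rightarrow> bool" where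
  "all_last_ok u v [] = True"
| "all_last_ok u v (w # ws) =
     (distribution_ok (histogram 5 (slopes 31 one_bits u v w)) \<and> all_last_ok u v ws)"

fun all_ok :: "bool list \<Rightarrow> bool list list \<Rightarrow> bool" where
  "all_ok u [] = True"
| "all_ok u (v # vs) = (all_last_ok u v (List.n_lists 5 [False, True]) \<and> all_ok u vs)"

lemma all_last_ok_iff:
  "all_last_ok u v ws \<longleftrightarrow>
     (\<forall>w\<in>set ws. distribution_ok (histogram 5 (slopes 31 one_bits u v w)))"
  by (induction ws) auto

lemma all_ok_iff:
  "all_ok u vs \<longleftrightarrow> (\<forall>v\<in>set vs. \<forall>w. length w = 5 \<longrightarrow>
     distribution_ok (histogram 5 (slopes 31 one_bits u v w)))"
proof -
  have "set (List.n_lists 5 [False, True]) = {w. length w = 5}"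
    by (auto simp: set_n_lists)
  then show ?thesis by (induction vs) (auto simp: all_last_ok_iff)
qed

definition normalized :: "bool list \<Rightarrow> bool list \<Rightarrow> bool list \<Rightarrow> bool" where
  "normalized u v w \<longleftrightarrow>
     length u = 5 \<and> length v = 5 \<and> length w = 5 \<and>
     (u = one_bits \<or> u = zero_bits \<and> v = one_bits \<or> u = zero_bits \<and> v = zero_bits \<and> w = one_bits)"

lemma enumeration_one: "all_ok one_bits (List.n_lists 5 [False, True])"
  by code_simp
lemma enumeration_zero_one: "all_ok zero_bits [one_bits]"
  by code_simp
lemma enumeration_zero_zero_one: "all_last_ok zero_bits zero_bits [one_bits]"
  by code_simp

lemma normalized_distribution_ok:
  assumes "normalized u v w"
  shows "distribution_ok (histogram 5 (slopes 31 one_bits u v w))"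
proof -
  have "set (List.n_lists 5 [False, True]) = {w. length w = 5}"
    by (auto simp: set_n_lists)
  then show ?thesis
    using assms enumeration_one enumeration_zero_one enumeration_zero_zero_one
    by (auto simp: normalized_def all_ok_iff all_last_ok_iff)
qed

section \<open>Weights read off from slopes\<close>

locale binary_plane_root = binary_plane emb for emb :: "'f::field \<Rightarrow> 'k::field" +
  fixes \<alpha> :: 'k
  assumes root: "\<alpha> ^ 5 = \<alpha> ^ 2 + 1"
begin

sublocale qf: quintic_field \<alpha>
  by unfold_locales (simp_all add: char2 card_big_field root)

text \<open>
  The link between geometry and computation: \<open>e\<close> enumerates the nonzero vectors, and the bit vectors
  in \<open>l\<close> encode their labels.  As \<open>qf.val\<close> is injective, labels and bit vectors have the same
  multiplicities.
\<close>

lemma card_points_of_weight_eq_histogram: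
  assumes U: "sub.subspace U"
    and T: "\<And>u v. u \<in> U - {0} \<Longrightarrow> v \<in> U - {0} \<Longrightarrow> T u = T v \<longleftrightarrow> pt u = pt v"
    and e: "bij_betw e {..<31} (U - {0})"
    and l: "map (\<lambda>i. T (e i)) [0..<31] = map qf.val l"
    and len: "\<And>bs. bs \<in> set l \<Longrightarrow> length bs = 5"
    and i: "i > 0"
  shows "card (points_of_weight emb U i) = count_list (histogram 5 l) (2 ^ i - 1)"
proof -
  have inj: "inj_on qf.val (set l)"
    using len qf.val_eq_iff by (auto simp: inj_on_def)
  have "card {m. count_list (map qf.val l) m = k} = card {bs. count_list l bs = k}" if "k > 0" for k
  proof -
    have mem: "bs \<in> set l" if "count_list l bs = k" for bs
      using that \<open>k > 0\<close> by (metis count_notin less_irrefl)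
    have "{m. count_list (map qf.val l) m = k} = qf.val ` {bs. count_list l bs = k}"
    proof (intro set_eqI iffI)
      fix m assume m: "m \<in> {m. count_list (map qf.val l) m = k}"
      then have "m \<in> set (map qf.val l)" using \<open>k > 0\<close> by (metis count_notin less_irrefl mem_Collect_eq)
      then show "m \<in> qf.val ` {bs. count_list l bs = k}"
        using m count_list_inj_map[OF inj] by auto
    next
      fix m assume "m \<in> qf.val ` {bs. count_list l bs = k}"
      then show "m \<in> {m. count_list (map qf.val l) m = k}"
        using count_list_inj_map[OF inj] mem by auto
    qed
    moreover have "inj_on qf.val {bs. count_list l bs = k}"
      by (rule inj_on_subset[OF inj]) (use mem in auto)
    ultimately show ?thesis by (simp add: card_image)
  qed
  moreover have "(2::nat) ^ i - 1 > 0" using i one_less_power[of "2::nat" i] by simp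
  ultimately show ?thesis
    using card_points_of_weight_label[OF U T i] card_fibre_eq_count_list[OF e, of T]
      card_multiplicity_eq_count_histogram[OF len]
    by (simp add: l)
qed

text \<open>
  In the graph of \<open>f\<close>, only the zero vector has first coordinate 0; two other vectors are
  proportional exactly when their slopes agree.
\<close>

lemma graph_of_additive_map:
  fixes f :: "'k \<Rightarrow> 'k"
  assumes add: "\<And>x y. f (x + y) = f x + f y"
  defines "U \<equiv> range (\<lambda>x. (x, f x))"
  shows graph_rank: "subspace_of_rank emb 5 U"
    and card_L_graph: "card (L U) = card ((\<lambda>x. f x / x) ` (UNIV - {0}))"
proof -
  have f0: "f 0 = 0" using add[of 0 0] by (metis add.right_neutral add_left_cancel)
  have "sub.subspace U"
    unfolding subspace_iff U_def using f0 add by (auto simp: zero_prod_def intro!: range_eqI)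
  moreover have "card U = 2 ^ 5"
    unfolding U_def by (subst card_image) (auto simp: inj_on_def card_big_field)
  ultimately show "subspace_of_rank emb 5 U" by (simp add: rank_iff_card)
  have nz: "fst u \<noteq> 0" if "u \<in> U - {0}" for u
    using that f0 by (auto simp: U_def zero_prod_def)
  have "card (L U) = card ((\<lambda>u. snd u / fst u) ` (U - {0}))"
    by (rule card_L_label) (use nz in \<open>auto simp: pt_eq_iff det2_def field_simps\<close>)
  also have "U - {0} = (\<lambda>x. (x, f x)) ` (UNIV - {0})"
    using f0 by (auto simp: U_def zero_prod_def)
  finally show "card (L U) = card ((\<lambda>x. f x / x) ` (UNIV - {0}))"
    by (simp add: image_image)
qed

text \<open>
  The graph of \<open>x^2\<close>: the slope at \<open>x\<close> is \<open>x\<close>, so all 31 slopes are different.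
\<close>

lemma linear_set_size_frobenius: "\<exists>S. linear_set emb 5 S \<and> card S = 31"
proof -
  have add: "(x + y) ^ 2 = x ^ 2 + y ^ 2" for x y :: 'k
    using char2 by (simp add: power2_sum)
  have "(\<lambda>x. x ^ 2 / x) ` (UNIV - {0}) = UNIV - {0 :: 'k}"
    by (auto simp: power2_eq_square image_iff)
  then have "card (L (range (\<lambda>x :: 'k. (x, x ^ 2)))) = 31"
    unfolding card_L_graph[of "\<lambda>x. x ^ 2", OF add] by (simp add: card_big_field)
  then show ?thesis
    using graph_rank[of "\<lambda>x. x ^ 2", OF add] unfolding linear_set_def by blast
qed

text \<open>
  Any choice of \<open>u, v, w\<close> comes from an additive map \<open>f\<close>: transport \<open>combine\<close> to the field along the
  bijection \<open>qf.val\<close>.  Additivity is checked bit by bit.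
\<close>

lemma linear_set_size_slopes:
  assumes "length u = 5" "length v = 5" "length w = 5"
  shows "\<exists>S. linear_set emb 5 S \<and> card S = length (histogram 5 (slopes 31 one_bits u v w))"
proof -
  define code where "code = inv_into {p. length p = 5} qf.val"
  have code: "length (code x) = 5" "qf.val (code x) = x" for x
    using bij_betw_inv_into_right[OF qf.bij_betw_val, of x]
      bij_betwE[OF bij_betw_inv_into[OF qf.bij_betw_val], rule_format, of x]
    by (simp_all add: code_def)
  have code_val: "code (qf.val p) = p" if "length p = 5" for p
    using that code qf.val_eq_iff by blast
  define f where "f x = qf.val (combine (code x) u v w)" for x
  have add_bits: "add_bits p q = code (qf.val p + qf.val q)" if "length p = 5" "length q = 5" for p q
    using code_val[of "add_bits p q"] that by (simp add: qf.val_add_bits)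
  have val_combine: "qf.val (combine [a, b, c, d, e] u v w) =
      of_bool c * qf.val u + (of_bool d * qf.val v + of_bool e * qf.val w)" for a b c d e
    using assms by (simp add: qf.val_add_bits)
  have add: "f (x + y) = f x + f y" for x y
  proof -
    obtain a b c d e where x: "code x = [a, b, c, d, e]" using code(1) by (rule length5E)
    obtain a' b' c' d' e' where y: "code y = [a', b', c', d', e']" using code(1) by (rule length5E)
    have "code (x + y) = add_bits (code x) (code y)"
      using add_bits[of "code x" "code y"] code by simp
    then have xy: "code (x + y) = [a \<noteq> a', b \<noteq> b', c \<noteq> c', d \<noteq> d', e \<noteq> e']"
      by (auto simp: x y)
    show ?thesis
      unfolding f_def x y xy val_combine
      by (cases c; cases c'; cases d; cases d'; cases e; cases e') (simp_all add: algebra_simps)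
  qed
  have basis: "f 1 = 0" "f \<alpha> = 0" "f (\<alpha> ^ 2) = qf.val u" "f (\<alpha> ^ 3) = qf.val v" "f (\<alpha> ^ 4) = qf.val w"
  proof -
    have f_val: "f x = qf.val (combine p u v w)" if "length p = 5" "qf.val p = x" for p x
      using code_val[OF that(1)] that(2) by (simp add: f_def)
    show "f 1 = 0"
      by (subst f_val[of "[True, False, False, False, False]"]) (auto simp: val_combine simp del: combine.simps)
    show "f \<alpha> = 0"
      by (subst f_val[of "[False, True, False, False, False]"]) (auto simp: val_combine simp del: combine.simps)
    show "f (\<alpha> ^ 2) = qf.val u"
      by (subst f_val[of "[False, False, True, False, False]"])
        (auto simp: val_combine power_numeral_reduce simp del: combine.simps)
    show "f (\<alpha> ^ 3) = qf.val v"
      by (subst f_val[of "[False, False, False, True, False]"])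
        (auto simp: val_combine power_numeral_reduce simp del: combine.simps)
    show "f (\<alpha> ^ 4) = qf.val w"
      by (subst f_val[of "[False, False, False, False, True]"])
        (auto simp: val_combine power_numeral_reduce simp del: combine.simps)
  qed
  let ?l = "slopes 31 one_bits u v w"
  have len: "length bs = 5" if "bs \<in> set ?l" for bs
    using length_slopes_entry[OF _ assms that] by simp
  have inj: "inj_on qf.val (set ?l)"
    using len qf.val_eq_iff by (auto simp: inj_on_def)
  have "(\<lambda>x. f x / x) ` (UNIV - {0}) = (\<lambda>i. f (\<alpha> ^ i) / \<alpha> ^ i) ` {..<31}"
    unfolding bij_betw_imp_surj_on[OF qf.bij_betw_root_powers, symmetric] by (simp add: image_image)
  also have "\<dots> = set (map (\<lambda>i. f (\<alpha> ^ i) / \<alpha> ^ i) [0..<31])" by auto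
  also have "\<dots> = qf.val ` set ?l"
    using qf.val_slopes[OF add basis assms, of 31] by (metis list.set_map)
  finally have "card (L (range (\<lambda>x. (x, f x)))) = length (histogram 5 ?l)"
    using card_L_graph[OF add] inj card_set_eq_length_histogram[OF len] by (simp add: card_image)
  then show ?thesis using graph_rank[OF add] unfolding linear_set_def by blast
qed

end

section \<open>The weight distribution\<close>

context binary_plane
begin

text \<open>
  The vectors \<open>(1, x)\<close> span 32 different points, whereas \<open>U\<close> has only 31 nonzero vectors.
\<close>

lemma ex_point_outside:
  fixes U :: "('k \<times> 'k) set"
  assumes "card U = 32" "0 \<in> U"
  obtains q where "q \<noteq> 0" "pt q \<notin> L U"
proof -
  have inj: "inj (\<lambda>x. pt (1 :: 'k, x))"
    by (rule injI) (simp add: pt_eq_iff zero_prod_def det2_def)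
  have "card (L U) \<le> card (U - {0})" unfolding L_eq_image by (rule card_image_le) simp
  also have "\<dots> < 32" using assms by simp
  also have "32 = card (range (\<lambda>x. pt (1 :: 'k, x)))" using inj card_big_field by (simp add: card_image)
  finally have "\<not> range (\<lambda>x. pt (1 :: 'k, x)) \<subseteq> L U"
    by (metis card_mono finite_imageI finite_plane L_eq_image linorder_not_less)
  then obtain x where "pt (1, x) \<notin> L U" by blast
  then show thesis by (rule that[rotated]) (simp add: zero_prod_def)
qed

text \<open>
  The coordinates are \<open>\<phi>\<close>, a multiple of \<open>det2 q\<close> for a vector \<open>q\<close> on no point of \<open>L U\<close>, and a multiple of
  \<open>det2 a\<close> for the point \<open>P = pt a\<close> of weight at least 2.  The first is injective on \<open>U\<close>, hence a
  bijection onto the field with an additive inverse \<open>g\<close>; the second then becomes the additive map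
  \<open>f x = d * det2 a (g x)\<close>, which vanishes on \<open>\<phi> ` (U \<inter> P)\<close>.  The factor \<open>c\<close> in \<open>\<phi>\<close> is chosen
  such that \<open>1\<close> and \<open>\<alpha>\<close> belong to this set, and \<open>d\<close> such that \<open>f\<close> is one of the normalized maps.
\<close>

lemma heavy_point_distribution:
  assumes U: "subspace_of_rank emb 5 U" and size: "card (L U) > 1"
    and P: "P \<in> L U" "weight emb U P \<ge> 2"
  obtains h where "distribution_ok h"
    "\<And>i. i > 0 \<Longrightarrow> card (points_of_weight emb U i) = count_list h (2 ^ i - 1)"
proof -
  have sU: "sub.subspace U" and cU: "card U = 32" using U by (simp_all add: rank_iff_card)
  have U0: "0 \<in> U" and Uadd: "\<And>u v. u \<in> U \<Longrightarrow> v \<in> U \<Longrightarrow> u + v \<in> U"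
    using sU by (auto simp: subspace_iff)
  obtain q where q: "q \<noteq> 0" "pt q \<notin> L U" using ex_point_outside[OF cU U0] .
  obtain a where a: "a \<in> U" "a \<noteq> 0" "P = pt a" using P(1) by (auto simp: L_eq_image)
  have "card (U \<inter> P) \<ge> 2 ^ 2"
    using card_weight[OF sU, of a] P(2) a(3) by (metis one_le_numeral power_increasing)
  then have "\<not> U \<inter> P \<subseteq> {0, a}"
    using card_mono[of "{0, a}" "U \<inter> P"] card_insert_le_m1[of 2 "{a}" 0] by force
  then obtain b where b: "b \<in> U" "b \<in> pt a" "b \<noteq> 0" "b \<noteq> a" using a by blast
  then obtain t where t: "b = scale2 t a" by (auto simp: pt_eq_scale)
  have "t \<noteq> 0" "t \<noteq> 1" using b t by (auto simp: scale2_def zero_prod_def)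
  moreover have "t ^ 32 = t" using \<open>t \<noteq> 0\<close> by (rule power_32)
  ultimately obtain c \<alpha> where \<alpha>: "\<alpha> ^ 5 = \<alpha> ^ 2 + 1"
    and span: "1 \<in> {c, c * t, c * (1 + t)}" "\<alpha> \<in> {c, c * t, c * (1 + t)}"
    using quintic_root_in_pencil[OF char2] by metis
  then interpret binary_plane_root emb \<alpha> by unfold_locales

  have qU: "u = 0" if "u \<in> U" "det2 q u = 0" for u
    using that q pt_eq_iff[of q u] by (auto simp: L_eq_image)
  \<comment> \<open>By this scaling, \<open>\<phi>\<close> maps \<open>a\<close>, \<open>b\<close>, \<open>a + b\<close> to \<open>c\<close>, \<open>c t\<close>, \<open>c (1 + t)\<close>, among which are 1 and \<open>\<alpha>\<close>.\<close>
  define \<phi> where "\<phi> u = c / det2 q a * det2 q u" for u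
  have qa: "det2 q a \<noteq> 0" using qU a by blast
  have c0: "c \<noteq> 0" using span(1) by auto
  have \<phi>_add: "\<phi> (u + v) = \<phi> u + \<phi> v" for u v by (simp add: \<phi>_def det2_add algebra_simps)
  have \<phi>_0: "\<phi> u = 0 \<longleftrightarrow> u = 0" if "u \<in> U" for u
    using qU[OF that] qa c0 by (auto simp: \<phi>_def)
  have inj: "inj_on \<phi> U"
  proof (rule inj_onI)
    fix u v assume uv: "u \<in> U" "v \<in> U" "\<phi> u = \<phi> v"
    then have "\<phi> (u + v) = 0" by (simp add: \<phi>_add)
    then have "u + v = 0" using \<phi>_0 Uadd uv by blast
    then show "u = v" by (metis add_right_cancel vec_add_self)
  qed
  have "\<phi> ` U = UNIV"
    by (rule card_seteq) (simp_all add: card_image[OF inj] cU card_big_field)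
  then have bij: "bij_betw \<phi> U UNIV" using inj by (simp add: bij_betw_def)
  define g where "g = inv_into U \<phi>"
  have gU: "g x \<in> U" and \<phi>_g: "\<phi> (g x) = x" for x
    using bij_betwE[OF bij_betw_inv_into[OF bij]] bij_betw_inv_into_right[OF bij] by (simp_all add: g_def)
  have g_\<phi>: "g (\<phi> u) = u" if "u \<in> U" for u
    unfolding g_def using inj that by simp
  have g_add: "g (x + y) = g x + g y" for x y
    using g_\<phi>[OF Uadd[OF gU gU, of x y]] by (simp add: \<phi>_add \<phi>_g)
  define f0 where "f0 x = det2 a (g x)" for x
  have f0_add: "f0 (x + y) = f0 x + f0 y" for x y by (simp add: f0_def g_add det2_add)
  have f0_ker: "f0 x = 0" if "x \<in> {c, c * t, c * (1 + t)}" for x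
  proof -
    have "\<phi> a = c" "\<phi> b = c * t" "\<phi> (a + b) = c * (1 + t)"
      using qa by (simp_all add: \<phi>_def t det2_add det2_scale algebra_simps)
    moreover have "det2 a b = 0" "det2 a (a + b) = 0" by (simp_all add: t det2_add det2_scale)
    ultimately have "\<exists>u\<in>U. \<phi> u = x \<and> det2 a u = 0"
      using that a b Uadd[of a b] by auto
    then show ?thesis using g_\<phi> by (auto simp: f0_def)
  qed
  have ker: "f0 1 = 0" "f0 \<alpha> = 0" using f0_ker span by blast+
  \<comment> \<open>Otherwise \<open>f0 = 0\<close>, all of \<open>U\<close> lies on the point \<open>pt a\<close>, and \<open>L U\<close> has only one point.\<close>
  have "\<not> (f0 (\<alpha> ^ 2) = 0 \<and> f0 (\<alpha> ^ 3) = 0 \<and> f0 (\<alpha> ^ 4) = 0)"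
  proof
    assume z: "f0 (\<alpha> ^ 2) = 0 \<and> f0 (\<alpha> ^ 3) = 0 \<and> f0 (\<alpha> ^ 4) = 0"
    have "f0 x = 0" for x
    proof -
      obtain p where p: "length p = 5" "qf.val p = x" using qf.ex_val by blast
      have "qf.val (combine p zero_bits zero_bits zero_bits) = 0"
        using p(1) by (rule length5E) (simp add: zero_bits_def)
      then show ?thesis
        using qf.additive_eq_combine[of f0 zero_bits zero_bits zero_bits p] f0_add ker z p by simp
    qed
    then have "det2 a u = 0" if "u \<in> U" for u using g_\<phi>[OF that] unfolding f0_def by metis
    then have "pt a = pt u" if "u \<in> U - {0}" for u using pt_eq_iff[of a u] that a by blast
    then have "L U \<subseteq> {pt a}" unfolding L_eq_image by blast
    then have "card (L U) \<le> card {pt a}" by (intro card_mono) simp_all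
    then show False using size by simp
  qed
  moreover have "x * (1 / x) = 1" if "x \<noteq> 0" for x :: 'k using that by simp
  ultimately obtain d where first: "f0 (\<alpha> ^ 2) * d = 1 \<or> f0 (\<alpha> ^ 2) = 0 \<and> f0 (\<alpha> ^ 3) * d = 1
      \<or> f0 (\<alpha> ^ 2) = 0 \<and> f0 (\<alpha> ^ 3) = 0 \<and> f0 (\<alpha> ^ 4) * d = 1"
    by metis
  then have d: "d \<noteq> 0" by auto
  define f where "f x = d * f0 x" for x
  have f_add: "f (x + y) = f x + f y" for x y by (simp add: f_def f0_add algebra_simps)
  obtain u v w where "length u = 5 \<and> qf.val u = f (\<alpha> ^ 2)" "length v = 5 \<and> qf.val v = f (\<alpha> ^ 3)"
    "length w = 5 \<and> qf.val w = f (\<alpha> ^ 4)"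
    using qf.ex_val by blast
  then have len: "length u = 5" "length v = 5" "length w = 5"
    and uvw: "f (\<alpha> ^ 2) = qf.val u" "f (\<alpha> ^ 3) = qf.val v" "f (\<alpha> ^ 4) = qf.val w"
    by simp_all
  have norm: "normalized u v w"
    using first d len uvw qf.val_eq_iff[of _ one_bits] qf.val_eq_iff[of _ zero_bits]
    by (auto simp: normalized_def f_def mult.commute)
  let ?l = "slopes 31 one_bits u v w" and ?e = "\<lambda>i. g (\<alpha> ^ i)"
  define T where "T u = f (\<phi> u) / \<phi> u" for u
  have "card (points_of_weight emb U i) = count_list (histogram 5 ?l) (2 ^ i - 1)" if i: "i > 0" for i
  proof (rule card_points_of_weight_eq_histogram[OF sU _ _ _ _ i, where T = T and e = ?e])
    fix x y assume x: "x \<in> U - {0}" and y: "y \<in> U - {0}"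
    have nz: "\<phi> x \<noteq> 0" "\<phi> y \<noteq> 0" using x y \<phi>_0 by auto
    have T: "T x = d * det2 a x / \<phi> x" "T y = d * det2 a y / \<phi> y"
      using x y by (simp_all add: T_def f_def f0_def g_\<phi>)
    have "T x = T y \<longleftrightarrow> d * det2 a x * \<phi> y = d * det2 a y * \<phi> x"
      unfolding T by (rule frac_eq_eq[OF nz])
    also have "\<dots> \<longleftrightarrow> d * (det2 a x * \<phi> y - det2 a y * \<phi> x) = 0"
      by (simp only: right_diff_distrib right_minus_eq mult.assoc)
    also have "det2 a x * \<phi> y - det2 a y * \<phi> x =
        c / det2 q a * (det2 a x * det2 q y - det2 a y * det2 q x)"
      by (simp only: \<phi>_def right_diff_distrib mult.left_commute)
    also have "\<dots> = c / det2 q a * (det2 a q * det2 x y)"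
      by (simp only: pluecker)
    also have "d * \<dots> = 0 \<longleftrightarrow> det2 x y = 0"
      using d qa c0 det2_swap[of a q] by simp
    also have "\<dots> \<longleftrightarrow> pt x = pt y" using x y pt_eq_iff[of x y] by simp
    finally show "T x = T y \<longleftrightarrow> pt x = pt y" .
  next
    have "g x \<noteq> 0" if "x \<noteq> 0" for x using that \<phi>_g[of x] \<phi>_0[OF U0] by metis
    then have "bij_betw g (UNIV - {0}) (U - {0})"
      by (intro bij_betw_byWitness[where f' = \<phi>]) (simp_all add: \<phi>_g g_\<phi> gU \<phi>_0 image_subset_iff)
    then show "bij_betw ?e {..<31} (U - {0})"
      using bij_betw_trans[OF qf.bij_betw_root_powers] by (simp add: o_def)
  next
    have "T (?e i) = f (\<alpha> ^ i) / \<alpha> ^ i" for i by (simp add: T_def \<phi>_g)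
    then show "map (\<lambda>i. T (?e i)) [0..<31] = map qf.val ?l"
      using qf.val_slopes[OF f_add _ _ uvw len, of 31] ker by (simp add: f_def)
  next
    show "length bs = 5" if "bs \<in> set ?l" for bs using length_slopes_entry[OF _ len that] by simp
  qed
  then show thesis using that normalized_distribution_ok[OF norm] by blast
qed

text \<open>
  Weight 5 would mean \<open>U \<subseteq> P\<close>, and then \<open>P\<close> would be the only point.
\<close>

lemma weight_range:
  assumes U: "subspace_of_rank emb 5 U" and size: "card (L U) > 1" and P: "P \<in> L U"
  shows "weight emb U P \<in> {1, 2, 3, 4}"
proof -
  have sU: "sub.subspace U" and cU: "card U = 2 ^ 5" using U by (simp_all add: rank_iff_card)
  obtain v where v: "v \<in> U" "v \<noteq> 0" "P = pt v" using P by (auto simp: L_eq_image)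
  have card: "card (U \<inter> P) = 2 ^ weight emb U P" using card_weight[OF sU] v(3) by simp
  have "weight emb U P \<noteq> 0"
  proof
    assume "weight emb U P = 0"
    then have "card (U \<inter> P) = 1" using card by simp
    moreover have "{0, v} \<subseteq> U \<inter> P"
      using v sub.subspace_0[OF sU] sub.subspace_0[OF subspace_pt] by simp
    then have "card {0, v} \<le> card (U \<inter> P)" by (intro card_mono) simp_all
    ultimately show False using v(2) by simp
  qed
  moreover have "weight emb U P < 5"
  proof (rule ccontr)
    assume "\<not> weight emb U P < 5"
    then have "card U \<le> card (U \<inter> P)" unfolding card cU by (intro power_increasing) simp_all
    then have "U \<inter> P = U" by (intro card_seteq) simp_all
    then have "det2 v u = 0" if "u \<in> U" for u using that v mem_pt_iff[of v u] by blast
    then have "pt v = pt u" if "u \<in> U - {0}" for u using pt_eq_iff[of v u] that v(2) by blast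
    then have "L U \<subseteq> {pt v}" unfolding L_eq_image by blast
    then have "card (L U) \<le> card {pt v}" by (intro card_mono) simp_all
    then show False using size by simp
  qed
  ultimately show ?thesis by auto
qed

text \<open>
  A point of weight 1 contains only one nonzero vector of \<open>U\<close>, so the 31 nonzero vectors lie on
  different points.
\<close>

lemma light_points:
  assumes U: "subspace_of_rank emb 5 U" and size: "card (L U) > 1"
    and light: "\<And>P. P \<in> L U \<Longrightarrow> weight emb U P \<le> 1"
  shows "card (points_of_weight emb U 1) = 31"
proof -
  have sU: "sub.subspace U" and cU: "card U = 32" using U by (simp_all add: rank_iff_card)
  have w1: "weight emb U P = 1" if "P \<in> L U" for P
    using weight_range[OF U size that] light[OF that] by auto
  then have "points_of_weight emb U 1 = pt ` (U - {0})"
    by (auto simp: points_of_weight_def simp flip: L_eq_image)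
  moreover have "inj_on pt (U - {0})"
  proof (rule inj_onI)
    fix u v assume uv: "u \<in> U - {0}" "v \<in> U - {0}" "pt u = pt v"
    have "{0, u, v} \<subseteq> U \<inter> pt v"
      using uv sub.subspace_0[OF sU] sub.subspace_0[OF subspace_pt] pt_self[of u] pt_self[of v]
      by simp
    then have "card {0, u, v} \<le> card (U \<inter> pt v)" by (rule card_mono[rotated]) simp
    also have "\<dots> = 2" using card_weight[OF sU, of v] w1[of "pt v"] uv(2) by (simp add: L_eq_image)
    finally show "u = v" using uv by (cases "u = v") auto
  qed
  ultimately show ?thesis using cU sub.subspace_0[OF sU] by (simp add: card_image)
qed

lemma weight_distribution:
  assumes U: "subspace_of_rank emb 5 U" and size: "card (L U) > 1"
  shows "(card (points_of_weight emb U 4), card (points_of_weight emb U 3),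
      card (points_of_weight emb U 2), card (points_of_weight emb U 1)) \<in> set
       [(1, 0, 0, 16),
        (0, 1, 0, 24), (0, 1, 2, 18), (0, 1, 4, 12),
        (0, 0, 2, 25), (0, 0, 3, 22), (0, 0, 4, 19), (0, 0, 5, 16), (0, 0, 6, 13),
        (0, 0, 0, 31)]"
proof (cases "\<exists>P\<in>L U. weight emb U P \<ge> 2")
  case True
  then obtain P where "P \<in> L U" "weight emb U P \<ge> 2" by blast
  from heavy_point_distribution[OF U size this] obtain h where
    ok: "distribution_ok h"
    and h: "\<And>i. i > 0 \<Longrightarrow> card (points_of_weight emb U i) = count_list h (2 ^ i - 1)" by blast
  have "card (points_of_weight emb U 4) = count_list h 15" "card (points_of_weight emb U 3) = count_list h 7"
    "card (points_of_weight emb U 2) = count_list h 3" "card (points_of_weight emb U 1) = count_list h 1"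
    using h[of 4] h[of 3] h[of 2] h[of 1] by simp_all
  then show ?thesis using ok unfolding distribution_ok_def by auto
next
  case False
  then have light: "weight emb U P \<le> 1" if "P \<in> L U" for P using that by fastforce
  then have "points_of_weight emb U i = {}" if "i > 1" for i
    using that by (fastforce simp: points_of_weight_def)
  then show ?thesis using light_points[OF U size light] by simp
qed

lemma finite_L [simp]: "finite (L (U :: ('k \<times> 'k) set))"
  unfolding L_eq_image by simp

lemma L_eq_union_points_of_weight:
  assumes "subspace_of_rank emb 5 U" "card (L U) > 1"
  shows "L U = points_of_weight emb U 4 \<union> points_of_weight emb U 3 \<union>
    points_of_weight emb U 2 \<union> points_of_weight emb U 1"
  using weight_range[OF assms] by (auto simp: points_of_weight_def)

lemma finite_points_of_weight [simp]: "finite (points_of_weight emb U i)"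
  unfolding points_of_weight_def by simp

lemma card_L_eq_sum:
  assumes "subspace_of_rank emb 5 U" "card (L U) > 1"
  shows "card (L U) = card (points_of_weight emb U 4) + card (points_of_weight emb U 3) +
    card (points_of_weight emb U 2) + card (points_of_weight emb U 1)"
proof -
  have "points_of_weight emb U i \<inter> points_of_weight emb U j = {}" if "i \<noteq> j" for i j
    using that by (auto simp: points_of_weight_def)
  then show ?thesis
    by (subst L_eq_union_points_of_weight[OF assms]) (simp add: card_Un_disjoint Int_Un_distrib2)
qed

lemma club_of_single_point:
  assumes "subspace_of_rank emb r U" "card (points_of_weight emb U k) = 1"
    "L U = points_of_weight emb U k \<union> points_of_weight emb U 1"
  shows "club emb r k (L U)"
proof -
  obtain P where P: "points_of_weight emb U k = {P}" using assms(2) by (rule card_1_singletonE)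
  then have "P \<in> L U" "weight emb U P = k" by (auto simp: points_of_weight_def)
  moreover have "weight emb U Q = 1" if "Q \<in> L U - {P}" for Q
  proof -
    have "Q \<in> points_of_weight emb U 1" using that assms(3) P by blast
    then show ?thesis by (simp add: points_of_weight_def)
  qed
  ultimately show ?thesis using assms(1) unfolding club_def by blast
qed

lemma ex_quintic_root: "\<exists>\<alpha> :: 'k. \<alpha> ^ 5 = \<alpha> ^ 2 + 1"
proof -
  have "\<not> (UNIV :: 'k set) \<subseteq> {0, 1}"
    using card_mono[of "{0, 1 :: 'k}" UNIV] card_big_field by auto
  then obtain t :: 'k where t: "t \<noteq> 0" "t \<noteq> 1" by blast
  from quintic_root_in_pencil[OF char2 power_32[OF t(1)] t] show ?thesis by metis
qed

text \<open>
  The witnesses come from a search through the normalized maps.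
\<close>

lemma example_sizes:
  "length (histogram 5 (slopes 31 one_bits one_bits zero_bits zero_bits)) = 17"
  "length (histogram 5 (slopes 31 one_bits one_bits [False, True, False, False, False] [True, False, True, False, True])) = 19"
  "length (histogram 5 (slopes 31 one_bits one_bits zero_bits [False, True, False, False, False])) = 21"
  "length (histogram 5 (slopes 31 one_bits one_bits [False, True, False, False, False] [True, False, False, False, True])) = 23"
  "length (histogram 5 (slopes 31 one_bits one_bits zero_bits [False, False, False, True, False])) = 25"
  "length (histogram 5 (slopes 31 one_bits one_bits [False, False, True, False, False] [False, True, False, True, True])) = 27"
  by code_simp+

lemma sizes_occur:
  assumes "n \<in> {17, 19, 21, 23, 25, 27, 31}"
  shows "\<exists>S. linear_set emb 5 S \<and> card S = n"
proof -
  obtain \<alpha> :: 'k where "\<alpha> ^ 5 = \<alpha> ^ 2 + 1" using ex_quintic_root by blast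
  then interpret binary_plane_root emb \<alpha> by unfold_locales
  note size = linear_set_size_slopes[of one_bits]
  show ?thesis
    using assms linear_set_size_frobenius example_sizes
      size[of zero_bits zero_bits]
      size[of "[False, True, False, False, False]" "[True, False, True, False, True]"]
      size[of zero_bits "[False, True, False, False, False]"]
      size[of "[False, True, False, False, False]" "[True, False, False, False, True]"]
      size[of zero_bits "[False, False, False, True, False]"]
      size[of "[False, False, True, False, False]" "[False, True, False, True, True]"]
    by auto
qed

end

theorem theorem1p2:
  fixes emb :: "'f::field \<Rightarrow> 'k::field"
  assumes "field_embedding emb" and "CARD('f) = 2" and "CARD('k) = 2 ^ 5"
  shows
    "(\<forall>U S. subspace_of_rank emb 5 U \<and> S = L U \<and> card S > 1 \<longrightarrow>
       (card (points_of_weight emb U 4) = 1 \<and> card (points_of_weight emb U 1) = 16 \<and>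
          S = points_of_weight emb U 4 \<union> points_of_weight emb U 1 \<and> club emb 5 4 S) \<or>
       (card (points_of_weight emb U 3) = 1 \<and> card (points_of_weight emb U 2) \<in> {0, 2, 4} \<and>
          S = points_of_weight emb U 3 \<union> points_of_weight emb U 2 \<union> points_of_weight emb U 1) \<or>
       (card (points_of_weight emb U 2) \<in> {2, 3, 4, 5, 6} \<and>
          S = points_of_weight emb U 2 \<union> points_of_weight emb U 1) \<or>
       (card (points_of_weight emb U 1) = 31 \<and> S = points_of_weight emb U 1 \<and>
          scattered emb 5 S)) \<and>
     {card S | S. linear_set emb 5 S \<and> card S > 1} = {17, 19, 21, 23, 25, 27, 31}"
proof (intro conjI allI impI)
  interpret binary_plane emb
    using assms by (simp add: binary_plane_def binary_plane_axioms_def)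
  fix U S assume "subspace_of_rank emb 5 U \<and> S = L U \<and> card S > 1"
  then have U: "subspace_of_rank emb 5 U" and S: "S = L U" and size: "card (L U) > 1" by auto
  let ?n = "\<lambda>i. card (points_of_weight emb U i)"
  have empty: "points_of_weight emb U i = {}" if "?n i = 0" for i
    using that by simp
  note union = L_eq_union_points_of_weight[OF U size]
  consider (four) "?n 4 = 1" "?n 3 = 0" "?n 2 = 0" "?n 1 = 16"
    | (three) "?n 4 = 0" "?n 3 = 1" "?n 2 \<in> {0, 2, 4}"
    | (two) "?n 4 = 0" "?n 3 = 0" "?n 2 \<in> {2, 3, 4, 5, 6}"
    | (one) "?n 4 = 0" "?n 3 = 0" "?n 2 = 0" "?n 1 = 31"
    using weight_distribution[OF U size] by auto
  then show "(?n 4 = 1 \<and> ?n 1 = 16 \<and> S = points_of_weight emb U 4 \<union> points_of_weight emb U 1 \<and>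
        club emb 5 4 S) \<or>
      (?n 3 = 1 \<and> ?n 2 \<in> {0, 2, 4} \<and>
        S = points_of_weight emb U 3 \<union> points_of_weight emb U 2 \<union> points_of_weight emb U 1) \<or>
      (?n 2 \<in> {2, 3, 4, 5, 6} \<and> S = points_of_weight emb U 2 \<union> points_of_weight emb U 1) \<or>
      (?n 1 = 31 \<and> S = points_of_weight emb U 1 \<and> scattered emb 5 S)"
  proof cases
    case four
    then have "L U = points_of_weight emb U 4 \<union> points_of_weight emb U 1"
      using union empty[of 3] empty[of 2] by simp
    then show ?thesis using four S club_of_single_point[OF U four(1)] by blast
  next
    case three
    then have "L U = points_of_weight emb U 3 \<union> points_of_weight emb U 2 \<union> points_of_weight emb U 1"
      using union empty[of 4] by simp
    then show ?thesis using three S by blast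
  next
    case two
    then have "L U = points_of_weight emb U 2 \<union> points_of_weight emb U 1"
      using union empty[of 4] empty[of 3] by simp
    then show ?thesis using two S by blast
  next
    case one
    then have L: "L U = points_of_weight emb U 1"
      using union empty[of 4] empty[of 3] empty[of 2] by simp
    then have "card S = (CARD('f) ^ 5 - 1) div (CARD('f) - 1)"
      using one(4) S by (simp add: card_prime_field)
    then have "scattered emb 5 S" using U S unfolding scattered_def linear_set_def by blast
    then show ?thesis using one(4) S L by blast
  qed
next
  interpret binary_plane emb
    using assms by (simp add: binary_plane_def binary_plane_axioms_def)
  have "card S \<in> {17, 19, 21, 23, 25, 27, 31}" if S: "linear_set emb 5 S" "card S > 1" for S
  proof -
    obtain U where U: "subspace_of_rank emb 5 U" "S = L U" using S(1) by (auto simp: linear_set_def)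
    then have size: "card (L U) > 1" using S(2) by simp
    show ?thesis
      using weight_distribution[OF U(1) size] card_L_eq_sum[OF U(1) size] U(2) by auto
  qed
  then have "{card S | S. linear_set emb 5 S \<and> card S > 1} \<subseteq> {17, 19, 21, 23, 25, 27, 31}"
    by (auto simp del: insert_iff)
  moreover have "\<exists>S. linear_set emb 5 S \<and> card S > 1 \<and> card S = n"
    if "n \<in> {17, 19, 21, 23, 25, 27, 31}" for n
  proof -
    have "n > 1" using that by auto
    then show ?thesis using sizes_occur[OF that] by auto
  qed
  then have "{17, 19, 21, 23, 25, 27, 31} \<subseteq> {card S | S. linear_set emb 5 S \<and> card S > 1}"
    by (intro subsetI CollectI) metis
  ultimately show "{card S | S. linear_set emb 5 S \<and> card S > 1} = {17, 19, 21, 23, 25, 27, 31}"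
    by (rule subset_antisym)
qed

end
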